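(* Let $(M,K)$ be an $m$-th root Cartan space, $m\ge 3$, with Cartan torsion $\mathbf C=(C^{ijk})$ and Landsberg curvature $\mathbf L=(L^{ijk})$. Suppose that $K$ is an isotropic Landsberg metric, i.e. there is a scalar function $c=c(x)$ on $M$ such that $$L^{ijk}+c\,K\,C^{ijk}=0\qquad\text{on } T^*M\setminus\{0\}\ \text{ for all } i,j,k .$$ Then $K$ is a Landsberg metric, i.e. $L^{ijk}=0$ for all $i,j,k$.
   Context: Let $M$ be an $n$-dimensional smooth manifold and $T^*M_0=T^*M\setminus\{0\}$. Local coordinates on $T^*M$ are written $(x,p)=(x_i,p_i)$; write $\partial^i=\partial/\partial x_i$ and $\dot\partial^i=\partial/\partial p_i$. Repeated indices are summed. All local quantities below are defined by their formulas in the charts of a fixed atlas of $M$, and identities between them are understood in these coordinates. A Cartan space $(M,K)$ is given by a positive function $K(x,p)$, smooth on $T^*M_0$, continuous on the zero section, positively $1$-homogeneous in $p$, such that $g^{ij}(x,p)=\frac12\dot\partial^i\dot\partial^jK^2$ is positive definite on $T^*M_0$. It is an $m$-th root Cartan space ($m\ge3$ an integer) if $$K(x,p)=\sqrt[m]{a^{i_1\dots i_m}(x)p_{i_1}\cdots p_{i_m}},$$ with (smooth) coefficients $a^{i_1\dots i_m}(x)$ depending only on $x$ and symmetric in all indices. Put $a^{ij}(x,p)=K^{-(m-2)}a^{iji_3\dots i_m}(x)p_{i_3}\cdots p_{i_m}$; the matrix $(a^{ij})$ is invertible. Generalized Christoffel symbols: $$\{i_1\dots i_m,j\}=\tfrac1{2(m-1)}\big(\partial^{i_1}a^{i_2\dots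 i_mj}+\partial^{i_2}a^{i_3\dots i_mi_1j}+\dots+\partial^{i_m}a^{i_1\dots i_{m-1}j}-\partial^ja^{i_1\dots i_m}\big),$$ and $\{00\dots0,h\}=\{i_1\dots i_m,h\}p_{i_1}\cdots p_{i_m}$. The spray coefficients $G_r(x,p)$ (geodesics: $\ddot x_i+2G_i(x,\dot x)=0$) are the unique solution of $a^{hr}G_r=\frac{1}{mK^{m-2}}\{00\dots0,h\}$. Put $G^i_r=\dot\partial^iG_r$, $G^{ij}_r=\dot\partial^jG^i_r$, $G^{ijk}_r=\dot\partial^kG^{ij}_r$ (the Berwald curvature). Cartan torsion: $C^{ijk}=-\frac12\dot\partial^kg^{ij}$. Landsberg curvature: $L^{ijk}=-\frac12p^sG^{ijk}_s$, where $p^s=g^{sj}p_j$. *)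

theory Defs
  imports "HOL-Analysis.Analysis" "HOL-Library.Multiset"
begin

section \<open>Calculus\<close>

definition pd :: "'n::finite \<Rightarrow> (real^'n \<Rightarrow> real) \<Rightarrow> real^'n \<Rightarrow> real" where
  "pd i f z = deriv (\<lambda>t. f (z + t *\<^sub>R axis i 1)) 0"

text \<open>Only used on open sets \<open>S\<close>.\<close>

primrec Ck_on :: "nat \<Rightarrow> 'a::euclidean_space set \<Rightarrow> ('a \<Rightarrow> 'b::real_normed_vector) \<Rightarrow> bool" where
  "Ck_on 0 S f \<longleftrightarrow> continuous_on S f"
| "Ck_on (Suc k) S f \<longleftrightarrow>
     f differentiable_on S \<and> (\<forall>v. Ck_on k S (\<lambda>z. frechet_derivative f (at z) v))"

definition smooth_on :: "'a::euclidean_space set \<Rightarrow> ('a \<Rightarrow> 'b::real_normed_vector) \<Rightarrow> bool" where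
  "smooth_on S f \<longleftrightarrow> (\<forall>k. Ck_on k S f)"


section \<open>Manifolds and the cotangent bundle\<close>

text \<open>A manifold is a Hausdorff, second countable type \<open>'m\<close> with an atlas covering it.
  A chart is a pair of its domain and its coordinate map, the latter relevant on the domain only.\<close>

type_synonym ('m, 'n) chart = "'m set \<times> ('m \<Rightarrow> real^'n)"

definition chart_image :: "('m, 'n::finite) chart \<Rightarrow> (real^'n) set" where
  "chart_image \<phi> = snd \<phi> ` fst \<phi>"

definition chart_inv :: "('m, 'n::finite) chart \<Rightarrow> real^'n \<Rightarrow> 'm" where
  "chart_inv \<phi> = inv_into (fst \<phi>) (snd \<phi>)"

definition transition :: "('m, 'n::finite) chart \<Rightarrow> ('m, 'n) chart \<Rightarrow> real^'n \<Rightarrow> real^'n" where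
  "transition \<phi> \<psi> = snd \<psi> \<circ> chart_inv \<phi>"

definition smooth_atlas ::
    "('m::{t2_space, second_countable_topology}, 'n::finite) chart set \<Rightarrow> bool" where
  "smooth_atlas \<A> \<longleftrightarrow>
     (\<Union>\<phi>\<in>\<A>. fst \<phi>) = UNIV \<and>
     (\<forall>\<phi>\<in>\<A>. open (fst \<phi>) \<and> open (chart_image \<phi>) \<and>
        homeomorphism (fst \<phi>) (chart_image \<phi>) (snd \<phi>) (chart_inv \<phi>)) \<and>
     (\<forall>\<phi>\<in>\<A>. \<forall>\<psi>\<in>\<A>. smooth_on (snd \<phi> ` (fst \<phi> \<inter> fst \<psi>)) (transition \<phi> \<psi>))"

text \<open>A covector at \<open>x\<close> is the family of its component vectors in the charts of the atlas around
  \<open>x\<close>, subject to \<open>p\<^sub>i = (\<partial>y\<^sub>j / \<partial>x\<^sub>i) q\<^sub>j\<close>; the value at all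
  other arguments is fixed to be \<open>0\<close>, so that equality of families is equality of covectors.\<close>

type_synonym ('m, 'n) covector = "('m, 'n) chart \<Rightarrow> real^'n"

definition cotangent_space ::
    "('m, 'n::finite) chart set \<Rightarrow> 'm \<Rightarrow> ('m, 'n) covector set" where
  "cotangent_space \<A> x =
     {\<xi>. (\<forall>\<phi>\<in>\<A>. \<forall>\<psi>\<in>\<A>. x \<in> fst \<phi> \<inter> fst \<psi> \<longrightarrow>
            (\<forall>i. \<xi> \<phi> $ i = (\<Sum>j\<in>UNIV. pd i (\<lambda>y. transition \<phi> \<psi> y $ j) (snd \<phi> x) * \<xi> \<psi> $ j))) \<and>
          (\<forall>\<phi>. \<phi> \<notin> \<A> \<or> x \<notin> fst \<phi> \<longrightarrow> \<xi> \<phi> = 0)}"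

definition cotangent_bundle ::
    "('m, 'n::finite) chart set \<Rightarrow> ('m \<times> ('m, 'n) covector) set" where
  "cotangent_bundle \<A> = Sigma UNIV (cotangent_space \<A>)"

text \<open>The expression \<open>F(x,p)\<close> of a function \<open>F\<close> on the cotangent bundle in the bundle chart
  induced by \<open>\<phi>\<close>.\<close>

definition bundle_chart ::
    "('m, 'n::finite) chart \<Rightarrow> 'm \<times> ('m, 'n) covector \<Rightarrow> (real^'n) \<times> (real^'n)" where
  "bundle_chart \<phi> v = (snd \<phi> (fst v), snd v \<phi>)"

definition in_chart ::
    "('m, 'n::finite) chart set \<Rightarrow> ('m, 'n) chart \<Rightarrow> ('m \<times> ('m, 'n) covector \<Rightarrow> real)
      \<Rightarrow> real^'n \<Rightarrow> real^'n \<Rightarrow> real" where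
  "in_chart \<A> \<phi> F x p =
     F (inv_into {v \<in> cotangent_bundle \<A>. fst v \<in> fst \<phi>} (bundle_chart \<phi>) (x, p))"


section \<open>Cartan spaces\<close>

text \<open>From here on, \<open>k\<close> denotes the coordinate expression \<open>K(x,p)\<close> of a function \<open>K\<close>, and
  \<open>a I x\<close>, for a list \<open>I\<close> of \<open>m\<close> indices, the coefficient with multi-index \<open>I\<close>.\<close>

definition fund_tensor ::
    "(real^'n \<Rightarrow> real^'n \<Rightarrow> real) \<Rightarrow> 'n::finite \<Rightarrow> 'n \<Rightarrow> real^'n \<Rightarrow> real^'n \<Rightarrow> real" where
  "fund_tensor k i j x p = 1/2 * pd i (pd j (\<lambda>q. (k x q)\<^sup>2)) p"

definition cartan_space ::
    "('m::{t2_space, second_countable_topology}, 'n::finite) chart set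
      \<Rightarrow> ('m \<times> ('m, 'n) covector \<Rightarrow> real) \<Rightarrow> bool" where
  "cartan_space \<A> K \<longleftrightarrow>
     smooth_atlas \<A> \<and>
     (\<forall>(x, \<xi>) \<in> cotangent_bundle \<A>. \<xi> \<noteq> (\<lambda>_. 0) \<longrightarrow> K (x, \<xi>) > 0) \<and>
     (\<forall>(x, \<xi>) \<in> cotangent_bundle \<A>. \<forall>t>0. K (x, \<lambda>\<phi>. t *\<^sub>R \<xi> \<phi>) = t * K (x, \<xi>)) \<and>
     (\<forall>\<phi>\<in>\<A>.
        smooth_on (chart_image \<phi> \<times> (UNIV - {0})) (\<lambda>(x, p). in_chart \<A> \<phi> K x p) \<and>
        continuous_on (chart_image \<phi> \<times> UNIV) (\<lambda>(x, p). in_chart \<A> \<phi> K x p) \<and>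
        (\<forall>x\<in>chart_image \<phi>. \<forall>p. p \<noteq> 0 \<longrightarrow>
           (\<forall>v. v \<noteq> 0 \<longrightarrow>
              (\<Sum>i\<in>UNIV. \<Sum>j\<in>UNIV. fund_tensor (in_chart \<A> \<phi> K) i j x p * v $ i * v $ j) > 0)))"

definition monomial :: "real^'n \<Rightarrow> 'n::finite list \<Rightarrow> real" where
  "monomial p I = prod_list (map (\<lambda>i. p $ i) I)"

text \<open>Contraction of the last \<open>r\<close> indices of \<open>a\<close> with \<open>p\<close>, the first ones being \<open>I\<close>.\<close>

definition contract ::
    "('n::finite list \<Rightarrow> real^'n \<Rightarrow> real) \<Rightarrow> nat \<Rightarrow> 'n list \<Rightarrow> real^'n \<Rightarrow> real^'n \<Rightarrow> real" where
  "contract a r I x p = (\<Sum>J | length J = r. a (I @ J) x * monomial p J)"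

definition mth_root_cartan_space ::
    "('m::{t2_space, second_countable_topology}, 'n::finite) chart set \<Rightarrow> nat
      \<Rightarrow> ('m \<times> ('m, 'n) covector \<Rightarrow> real)
      \<Rightarrow> (('m, 'n) chart \<Rightarrow> 'n list \<Rightarrow> real^'n \<Rightarrow> real) \<Rightarrow> bool" where
  "mth_root_cartan_space \<A> m K a \<longleftrightarrow>
     cartan_space \<A> K \<and>
     (\<forall>\<phi>\<in>\<A>.
        (\<forall>I. length I = m \<longrightarrow> smooth_on (chart_image \<phi>) (a \<phi> I)) \<and>
        (\<forall>I J. \<forall>x\<in>chart_image \<phi>. length I = m \<longrightarrow> mset I = mset J \<longrightarrow> a \<phi> I x = a \<phi> J x) \<and>
        (\<forall>x\<in>chart_image \<phi>. \<forall>p. in_chart \<A> \<phi> K x p = root m (contract (a \<phi>) m [] x p)))"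


section \<open>Spray, Berwald and Landsberg curvature, Cartan torsion\<close>

text \<open>The Christoffel symbols, spray, Berwald and Landsberg coefficients are given by their formulas in
  each chart of the fixed atlas; they are not claimed to transform as tensors.\<close>

definition a_matrix ::
    "nat \<Rightarrow> (real^'n \<Rightarrow> real^'n \<Rightarrow> real) \<Rightarrow> ('n::finite list \<Rightarrow> real^'n \<Rightarrow> real)
      \<Rightarrow> 'n \<Rightarrow> 'n \<Rightarrow> real^'n \<Rightarrow> real^'n \<Rightarrow> real" where
  "a_matrix m k a i j x p = contract a (m - 2) [i, j] x p / k x p ^ (m - 2)"

text \<open>For \<open>I = [i\<^sub>0, \<dots>, i\<^sub>m\<^sub>-\<^sub>1]\<close>, the list \<open>tl (rotate l I)\<close> is
  \<open>I\<close> cyclically continued from after position \<open>l\<close>, with \<open>i\<^sub>l\<close> left out.\<close>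

definition christoffel ::
    "nat \<Rightarrow> ('n::finite list \<Rightarrow> real^'n \<Rightarrow> real) \<Rightarrow> 'n list \<Rightarrow> 'n \<Rightarrow> real^'n \<Rightarrow> real" where
  "christoffel m a I j x =
     1 / (2 * (real m - 1)) *
       ((\<Sum>l<m. pd (I ! l) (a (tl (rotate l I) @ [j])) x) - pd j (a I) x)"

definition christoffel0 ::
    "nat \<Rightarrow> ('n::finite list \<Rightarrow> real^'n \<Rightarrow> real) \<Rightarrow> 'n \<Rightarrow> real^'n \<Rightarrow> real^'n \<Rightarrow> real" where
  "christoffel0 m a h x p = (\<Sum>I | length I = m. christoffel m a I h x * monomial p I)"

definition spray ::
    "nat \<Rightarrow> (real^'n \<Rightarrow> real^'n \<Rightarrow> real) \<Rightarrow> ('n::finite list \<Rightarrow> real^'n \<Rightarrow> real)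
      \<Rightarrow> real^'n \<Rightarrow> real^'n \<Rightarrow> real^'n" where
  "spray m k a x p =
     (THE G. \<forall>h. (\<Sum>r\<in>UNIV. a_matrix m k a h r x p * G $ r)
                  = 1 / (real m * k x p ^ (m - 2)) * christoffel0 m a h x p)"

definition berwald ::
    "nat \<Rightarrow> (real^'n \<Rightarrow> real^'n \<Rightarrow> real) \<Rightarrow> ('n::finite list \<Rightarrow> real^'n \<Rightarrow> real)
      \<Rightarrow> 'n \<Rightarrow> 'n \<Rightarrow> 'n \<Rightarrow> 'n \<Rightarrow> real^'n \<Rightarrow> real^'n \<Rightarrow> real" where
  "berwald m k a i j l r x p = pd l (pd j (pd i (\<lambda>q. spray m k a x q $ r))) p"

definition landsberg ::
    "nat \<Rightarrow> (real^'n \<Rightarrow> real^'n \<Rightarrow> real) \<Rightarrow> ('n::finite list \<Rightarrow> real^'n \<Rightarrow> real)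
      \<Rightarrow> 'n \<Rightarrow> 'n \<Rightarrow> 'n \<Rightarrow> real^'n \<Rightarrow> real^'n \<Rightarrow> real" where
  "landsberg m k a i j l x p =
     - 1/2 * (\<Sum>s\<in>UNIV. (\<Sum>r\<in>UNIV. fund_tensor k s r x p * p $ r) * berwald m k a i j l s x p)"

definition cartan_torsion ::
    "(real^'n \<Rightarrow> real^'n \<Rightarrow> real) \<Rightarrow> 'n::finite \<Rightarrow> 'n \<Rightarrow> 'n \<Rightarrow> real^'n \<Rightarrow> real^'n \<Rightarrow> real" where
  "cartan_torsion k i j l x p = - 1/2 * pd l (fund_tensor k i j x) p"

definition isotropic_landsberg_metric ::
    "('m, 'n::finite) chart set \<Rightarrow> nat \<Rightarrow> ('m \<times> ('m, 'n) covector \<Rightarrow> real)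
      \<Rightarrow> (('m, 'n) chart \<Rightarrow> 'n list \<Rightarrow> real^'n \<Rightarrow> real) \<Rightarrow> bool" where
  "isotropic_landsberg_metric \<A> m K a \<longleftrightarrow>
     (\<exists>c :: 'm \<Rightarrow> real. \<forall>\<phi>\<in>\<A>. \<forall>x\<in>chart_image \<phi>. \<forall>p. p \<noteq> 0 \<longrightarrow> (\<forall>i j l.
        landsberg m (in_chart \<A> \<phi> K) (a \<phi>) i j l x p
          + c (chart_inv \<phi> x) * in_chart \<A> \<phi> K x p * cartan_torsion (in_chart \<A> \<phi> K) i j l x p = 0))"

definition landsberg_metric ::
    "('m, 'n::finite) chart set \<Rightarrow> nat \<Rightarrow> ('m \<times> ('m, 'n) covector \<Rightarrow> real)
      \<Rightarrow> (('m, 'n) chart \<Rightarrow> 'n list \<Rightarrow> real^'n \<Rightarrow> real) \<Rightarrow> bool" where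
  "landsberg_metric \<A> m K a \<longleftrightarrow>
     (\<forall>\<phi>\<in>\<A>. \<forall>x\<in>chart_image \<phi>. \<forall>p. p \<noteq> 0 \<longrightarrow> (\<forall>i j l.
        landsberg m (in_chart \<A> \<phi> K) (a \<phi>) i j l x p = 0))"

end

theory Submission
  imports Defs
begin

text \<open>Replacing \<open>p\<close> by \<open>-p\<close> multiplies \<open>K\<^sup>m\<close>, a form of degree \<open>m\<close> in
  \<open>p\<close>, by \<open>(-1)\<^sup>m\<close>; since \<open>K\<close> is positive on both sides, \<open>m\<close> is even. Hence \<open>K\<close>,
  the metric tensor and the spray coefficients are even in \<open>p\<close>. Each derivative in \<open>p\<close> changes
  the parity, so the Landsberg curvature is even while \<open>c K C\<close> is odd, and the isotropy
  equations at \<open>p\<close> and \<open>-p\<close> force both to vanish.\<close>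

section \<open>Partial derivatives\<close>

text \<open>Chain rule along the coordinate line through \<open>z\<close>. Since \<open>pd\<close>
  is a one-variable \<open>deriv\<close>, this is the bridge from total derivatives to every later
  computation.\<close>

lemma pd_eq_derivative:
  assumes "(f has_derivative D) (at z)"
  shows "pd i f z = D (axis i 1)"
proof -
  have "((\<lambda>t. z + t *\<^sub>R axis i (1::real)) has_derivative (\<lambda>t. t *\<^sub>R axis i 1)) (at 0)"
    by (auto intro!: derivative_eq_intros)
  then have "((\<lambda>t. f (z + t *\<^sub>R axis i 1)) has_derivative (\<lambda>t. D (t *\<^sub>R axis i 1))) (at 0)"
    using has_derivative_compose[of "\<lambda>t. z + t *\<^sub>R axis i (1::real)" _ 0 UNIV f D] assms by simp
  moreover have "(\<lambda>t. D (t *\<^sub>R axis i 1)) = (*) (D (axis i 1))"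
    using linear_scale[OF has_derivative_linear[OF assms]] by (auto simp: mult.commute)
  ultimately show ?thesis
    unfolding pd_def by (intro DERIV_imp_deriv) (simp add: has_field_derivative_def)
qed

text \<open>The coordinate line through \<open>z\<close> stays in \<open>S\<close> for small
  \<open>t\<close>, and \<open>deriv\<close> depends only on the germ at 0. Formulas that hold only
  off the origin, or only on a chart overlap, can therefore be differentiated.\<close>

lemma pd_cong_open:
  assumes "open S" "z \<in> S" and eq: "\<And>q. q \<in> S \<Longrightarrow> f q = g q"
  shows "pd i f z = pd i g z"
proof -
  have "((\<lambda>t::real. z + t *\<^sub>R axis i 1) \<longlongrightarrow> z + 0 *\<^sub>R axis i 1) (nhds 0)"
    by (intro tendsto_intros filterlim_ident)
  then have "\<forall>\<^sub>F t::real in nhds 0. z + t *\<^sub>R axis i 1 \<in> S"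
    using assms(1,2) topological_tendstoD by fastforce
  then show ?thesis
    unfolding pd_def using eq by (intro deriv_cong_ev) (auto elim: eventually_mono)
qed

lemma pd_cong_nonzero:
  assumes "z \<noteq> 0" "\<And>q. q \<noteq> 0 \<Longrightarrow> f q = g q"
  shows "pd i f z = pd i g z"
  using assms by (intro pd_cong_open[of "- {0}"]) auto

text \<open>Off the origin \<open>f\<close> is \<open>s\<close> times its composite with the
  reflection, whose derivative contributes one factor -1. The parameter \<open>s\<close> is 1 for
  even and -1 for odd functions.\<close>

lemma pd_reflect:
  assumes "f differentiable at p" "p \<noteq> 0" and refl: "\<And>q. q \<noteq> 0 \<Longrightarrow> f (- q) = s * f q"
  shows "pd i f (- p) = - s * pd i f p"
proof -
  obtain D where D: "(f has_derivative D) (at p)"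
    using assms(1) by (auto simp: differentiable_def)
  have "(uminus has_derivative uminus) (at (- p))"
    by (auto intro!: derivative_eq_intros)
  then have "((\<lambda>q. f (- q)) has_derivative (\<lambda>v. D (- v))) (at (- p))"
    using has_derivative_compose[of uminus uminus "- p" UNIV f D] D by simp
  then have "((\<lambda>q. s * f (- q)) has_derivative (\<lambda>v. s * D (- v))) (at (- p))"
    by (rule has_derivative_mult_right)
  then have "pd i (\<lambda>q. s * f (- q)) (- p) = s * D (- axis i 1)"
    by (rule pd_eq_derivative)
  moreover have "pd i f (- p) = pd i (\<lambda>q. s * f (- q)) (- p)"
  proof (rule pd_cong_nonzero)
    show "f q = s * f (- q)" if "q \<noteq> 0" for q
      using refl[of "- q"] that by simp
  qed (use assms(2) in simp)
  ultimately show ?thesis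
    using pd_eq_derivative[OF D] linear_neg[OF has_derivative_linear[OF D]] by simp
qed

text \<open>The Isabelle derivative of a non-differentiable function is an arbitrary number, so parity of
  \<^const>\<open>pd\<close> requires differentiability. This class of functions on the complement of the origin
  is closed under \<^const>\<open>pd\<close> and contains everything the theorem differentiates.\<close>

inductive elementary :: "(real^'n::finite \<Rightarrow> real) \<Rightarrow> bool" where
  const: "elementary (\<lambda>_. c)"
| component: "elementary (\<lambda>p. p $ i)"
| add: "elementary f \<Longrightarrow> elementary g \<Longrightarrow> elementary (\<lambda>p. f p + g p)"
| mult: "elementary f \<Longrightarrow> elementary g \<Longrightarrow> elementary (\<lambda>p. f p * g p)"
| power_real: "elementary f \<Longrightarrow> (\<And>p. p \<noteq> 0 \<Longrightarrow> f p > 0) \<Longrightarrow> elementary (\<lambda>p. f p powr c)"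
| cong: "elementary f \<Longrightarrow> (\<And>p. p \<noteq> 0 \<Longrightarrow> g p = f p) \<Longrightarrow> elementary g"

lemma elementary_sum: "(\<And>x. x \<in> A \<Longrightarrow> elementary (f x)) \<Longrightarrow> elementary (\<lambda>p. \<Sum>x\<in>A. f x p)"
  by (induction A rule: infinite_finite_induct) (auto intro: elementary.const elementary.add)

lemma elementary_prod: "(\<And>x. x \<in> A \<Longrightarrow> elementary (f x)) \<Longrightarrow> elementary (\<lambda>p. \<Prod>x\<in>A. f x p)"
  by (induction A rule: infinite_finite_induct) (auto intro: elementary.const elementary.mult)

text \<open>The rule for \<open>powr\<close> covers positive functions only. For a function of
  unknown sign, such as a determinant known merely to be nonzero, the square is positive, and 1/f =
  f * (f^2)^(-1).\<close>

lemma elementary_inverse: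
  assumes "elementary f" "\<And>p. p \<noteq> 0 \<Longrightarrow> f p \<noteq> 0"
  shows "elementary (\<lambda>p. inverse (f p))"
proof (rule elementary.cong)
  show "elementary (\<lambda>p. f p * (f p * f p) powr (- 1))"
    using assms by (intro elementary.mult elementary.power_real) (auto simp: zero_less_mult_iff linorder_neq_iff)
  show "inverse (f p) = f p * (f p * f p) powr (- 1)" if "p \<noteq> 0" for p
    using assms(2)[OF that] by (simp add: powr_minus zero_less_mult_iff linorder_neq_iff)
qed

lemma elementary_det:
  fixes M :: "real^'n::finite \<Rightarrow> real^'k^'k"
  assumes "\<And>i j. elementary (\<lambda>p. M p $ i $ j)"
  shows "elementary (\<lambda>p. det (M p))"
  unfolding det_def by (intro elementary_sum elementary.mult elementary_prod elementary.const assms)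

text \<open>Both claims go through one induction: the product and power rules need differentiability
  of the parts, and they express the new \<open>pd\<close> through the parts and their
  \<open>pd\<close>. These formulas hold off the origin, which is what the rule \<open>cong\<close>
  asks for.\<close>

lemma elementary_differentiable_and_pd:
  fixes f :: "real^'n::finite \<Rightarrow> real"
  assumes "elementary f"
  shows "(\<forall>p. p \<noteq> 0 \<longrightarrow> f differentiable at p) \<and> (\<forall>i. elementary (pd i f))"
  using assms
proof induction
  case (const c)
  have "pd i (\<lambda>_. c) = (\<lambda>_. 0)" for i :: 'n
    by (rule ext, subst pd_eq_derivative) (auto intro!: derivative_eq_intros)
  then show ?case by (auto intro: elementary.const)
next
  case (component k)
  have D: "((\<lambda>p. p $ k) has_derivative (\<lambda>v. v $ k)) (at p)" for p :: "real^'n"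
    by (rule bounded_linear.has_derivative[OF bounded_linear_vec_nth has_derivative_ident])
  have "pd i (\<lambda>p. p $ k) = (\<lambda>_. axis i 1 $ k)" for i :: 'n
    by (rule ext, rule pd_eq_derivative[OF D])
  then show ?case using D by (auto intro: elementary.const simp: differentiable_def)
next
  case (add f g)
  have D: "\<exists>D E. (f has_derivative D) (at p) \<and> (g has_derivative E) (at p)" if "p \<noteq> 0" for p
    using add that by (auto simp: differentiable_def)
  have eq: "pd i (\<lambda>p. f p + g p) p = pd i f p + pd i g p" if "p \<noteq> 0" for i p
    using D[OF that] by (auto simp: pd_eq_derivative[OF has_derivative_add] pd_eq_derivative)
  have "elementary (pd i (\<lambda>p. f p + g p))" for i
    by (rule elementary.cong[OF elementary.add[of "pd i f" "pd i g"]]) (use add eq in auto)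
  then show ?case using add by auto
next
  case (mult f g)
  have D: "\<exists>D E. (f has_derivative D) (at p) \<and> (g has_derivative E) (at p)" if "p \<noteq> 0" for p
    using mult that by (auto simp: differentiable_def)
  have eq: "pd i (\<lambda>p. f p * g p) p = f p * pd i g p + pd i f p * g p" if "p \<noteq> 0" for i p
    using D[OF that] by (auto simp: pd_eq_derivative[OF has_derivative_mult] pd_eq_derivative)
  have "elementary (pd i (\<lambda>p. f p * g p))" for i
    by (rule elementary.cong[OF elementary.add[OF elementary.mult[of f "pd i g"]
      elementary.mult[of "pd i f" g]]]) (use mult eq in auto)
  then show ?case using mult by auto
next
  case (power_real f c)
  have D: "\<exists>D. (f has_derivative D) (at p) \<and>
      ((\<lambda>p. f p powr c) has_derivative (\<lambda>v. (c * f p powr (c - 1)) * D v)) (at p)"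
    if "p \<noteq> 0" for p
  proof -
    have "f differentiable at p"
      using power_real.IH that by blast
    then obtain D where D: "(f has_derivative D) (at p)"
      unfolding differentiable_def by blast
    have pow: "((\<lambda>x. x powr c) has_derivative (\<lambda>v. (c * f p powr (c - 1)) * v)) (at (f p))"
      using has_real_derivative_powr[OF power_real.hyps(2)[OF that], of c]
      by (simp add: has_field_derivative_def)
    show ?thesis
      using D has_derivative_compose[OF D pow] by (intro exI[of _ D] conjI)
  qed
  have eq: "pd i (\<lambda>p. f p powr c) p = (c * f p powr (c - 1)) * pd i f p" if "p \<noteq> 0" for i p
    using D[OF that] by (auto simp: pd_eq_derivative)
  \<comment> \<open>The class allows every real exponent on a positive base, so lowering
    \<open>c\<close> by one stays inside it.\<close>
  have "elementary (pd i (\<lambda>p. f p powr c))" for i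
    by (rule elementary.cong[OF elementary.mult[OF elementary.mult[OF elementary.const[of c]
      elementary.power_real[of f "c - 1"]], of "pd i f"]])
      (use power_real eq in auto)
  then show ?case using D by (auto simp: differentiable_def)
next
  case (cong f g)
  have "g differentiable at p" if "p \<noteq> 0" for p
    using cong that has_derivative_transform_within_open[of f _ p UNIV "- {0}" g]
    by (fastforce simp: differentiable_def)
  moreover have "elementary (pd i g)" for i
    by (rule elementary.cong[of "pd i f"]) (use cong in \<open>auto intro: pd_cong_nonzero\<close>)
  ultimately show ?case by blast
qed

lemma elementary_differentiable: "elementary f \<Longrightarrow> p \<noteq> 0 \<Longrightarrow> f differentiable at p"
  and elementary_pd: "elementary f \<Longrightarrow> elementary (pd i f)"
  using elementary_differentiable_and_pd by blast+

lemma elementary_pd_reflect: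
  assumes "elementary f" "\<And>q. q \<noteq> 0 \<Longrightarrow> f (- q) = s * f q" "p \<noteq> 0"
  shows "pd i f (- p) = - s * pd i f p"
  using assms by (intro pd_reflect elementary_differentiable)


section \<open>Homogeneous polynomials with symmetric coefficients\<close>

lemma monomial_minus: "monomial (- p) I = (- 1) ^ length I * monomial p I"
  by (induction I) (auto simp: monomial_def)

lemma finite_lists_of_length: "finite {J::'n::finite list. length J = r}"
  using finite_lists_length_eq[of "UNIV :: 'n set" r] by simp

lemma contract_minus: "contract a r I x (- p) = (- 1) ^ r * contract a r I x p"
  unfolding contract_def sum_distrib_left
  by (intro sum.cong) (auto simp: monomial_minus)

lemma contract_0: "contract a 0 I x p = a I x"
  by (simp add: contract_def monomial_def)

text \<open>The head of the contracted list is split off and becomes the last free index. This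
  recursion drives the induction for the derivative.\<close>

lemma contract_Suc: "contract a (Suc r) I x p = (\<Sum>j\<in>UNIV. p $ j * contract a r (I @ [j]) x p)"
proof -
  have lists: "{J::'a list. length J = Suc r} = (\<lambda>(j, J). j # J) ` (UNIV \<times> {J. length J = r})"
    by (auto simp: length_Suc_conv image_iff)
  have "contract a (Suc r) I x p =
      (\<Sum>(j, J)\<in>UNIV \<times> {J. length J = r}. a (I @ j # J) x * monomial p (j # J))"
    unfolding contract_def lists
    by (subst sum.reindex) (auto simp: inj_on_def split_beta intro!: sum.cong)
  also have "\<dots> = (\<Sum>j\<in>UNIV. \<Sum>J\<in>{J. length J = r}. a (I @ j # J) x * monomial p (j # J))"
    by (rule sum.cartesian_product[symmetric])
  also have "\<dots> = (\<Sum>j\<in>UNIV. p $ j * contract a r (I @ [j]) x p)"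
    unfolding contract_def sum_distrib_left by (auto simp: monomial_def intro!: sum.cong)
  finally show ?thesis .
qed

lemma elementary_monomial: "elementary (\<lambda>p. monomial p I)"
  by (induction I) (auto simp: monomial_def intro: elementary.const elementary.component elementary.mult)

lemma elementary_contract: "elementary (contract a r I x)"
  unfolding contract_def
  by (intro elementary_sum elementary.mult elementary.const elementary_monomial)

lemma contract_mset_eq:
  assumes sym: "\<And>I J. length I = m \<Longrightarrow> mset I = mset J \<Longrightarrow> a I x = a J x"
    and "length I + r = m" "mset I = mset I'"
  shows "contract a r I x p = contract a r I' x p"
  unfolding contract_def using assms(2,3) by (intro sum.cong) (auto intro!: sym)

text \<open>Induction over \<open>contract_Suc\<close> with the product rule: the explicit factor
  \<open>p $ j\<close> yields one copy of the contraction, the induction hypothesis yields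
  \<open>r\<close> further copies once symmetry has reordered the free indices.\<close>

lemma contract_has_derivative:
  assumes sym: "\<And>I J. length I = m \<Longrightarrow> mset I = mset J \<Longrightarrow> a I x = a J x"
    and "length I + r = m"
  shows "(contract a r I x has_derivative
    (\<lambda>v. real r * (\<Sum>i\<in>UNIV. v $ i * contract a (r - 1) (I @ [i]) x p))) (at p)"
  using assms(2)
proof (induction r arbitrary: I)
  case 0
  then show ?case by (auto simp: contract_0[abs_def])
next
  case (Suc r)
  \<comment> \<open>This is \<open>contract_Suc\<close> after swapping the free indices
    \<open>i\<close> and \<open>j\<close>. For \<open>r = 0\<close> the truncated
    \<open>r - 1\<close> is harmless, because the factor \<open>real r\<close> kills both
    sides.\<close>
  have euler: "real r * contract a r (I @ [i]) x p =
      (\<Sum>j\<in>UNIV. p $ j * (real r * contract a (r - 1) (I @ [j] @ [i]) x p))" for i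
  proof (cases r)
    case (Suc r')
    have "contract a r' (I @ [i] @ [j]) x p = contract a r' (I @ [j] @ [i]) x p" for j
      using Suc.prems Suc by (intro contract_mset_eq[where m = m and a = a and x = x, OF sym]) auto
    with Suc show ?thesis by (simp add: contract_Suc sum_distrib_left algebra_simps)
  qed simp
  have IH: "(contract a r (I @ [j]) x has_derivative
      (\<lambda>v. real r * (\<Sum>i\<in>UNIV. v $ i * contract a (r - 1) (I @ [j] @ [i]) x p))) (at p)" for j
    using Suc.IH[of "I @ [j]"] Suc.prems by simp
  have "((\<lambda>p. \<Sum>j\<in>UNIV. p $ j * contract a r (I @ [j]) x p) has_derivative
      (\<lambda>v. \<Sum>j\<in>UNIV. p $ j * (real r * (\<Sum>i\<in>UNIV. v $ i * contract a (r - 1) (I @ [j] @ [i]) x p))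
        + v $ j * contract a r (I @ [j]) x p)) (at p)"
    by (intro has_derivative_sum has_derivative_mult IH
        bounded_linear.has_derivative[OF bounded_linear_vec_nth has_derivative_ident])
  moreover have "(\<lambda>v. \<Sum>j\<in>UNIV. p $ j * (real r * (\<Sum>i\<in>UNIV. v $ i * contract a (r - 1) (I @ [j] @ [i]) x p))
        + v $ j * contract a r (I @ [j]) x p)
      = (\<lambda>v. real (Suc r) * (\<Sum>i\<in>UNIV. v $ i * contract a r (I @ [i]) x p))"
  proof
    fix v :: "real^'a"
    have "(\<Sum>j\<in>UNIV. p $ j * (real r * (\<Sum>i\<in>UNIV. v $ i * contract a (r - 1) (I @ [j] @ [i]) x p)))
        = (\<Sum>i\<in>UNIV. v $ i * (\<Sum>j\<in>UNIV. p $ j * (real r * contract a (r - 1) (I @ [j] @ [i]) x p)))"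
      unfolding sum_distrib_left by (subst sum.swap) (simp add: mult_ac)
    also have "\<dots> = real r * (\<Sum>i\<in>UNIV. v $ i * contract a r (I @ [i]) x p)"
      unfolding euler[symmetric] by (simp add: sum_distrib_left mult_ac)
    finally show "(\<Sum>j\<in>UNIV. p $ j * (real r * (\<Sum>i\<in>UNIV. v $ i * contract a (r - 1) (I @ [j] @ [i]) x p))
        + v $ j * contract a r (I @ [j]) x p)
      = real (Suc r) * (\<Sum>i\<in>UNIV. v $ i * contract a r (I @ [i]) x p)"
      by (simp add: sum.distrib algebra_simps)
  qed
  ultimately show ?case by (simp add: contract_Suc[abs_def])
qed

lemma pd_contract:
  assumes "\<And>I J. length I = m \<Longrightarrow> mset I = mset J \<Longrightarrow> a I x = a J x"
    and "length I + r = m"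
  shows "pd i (contract a r I x) p = real r * contract a (r - 1) (I @ [i]) x p"
  using pd_eq_derivative[OF contract_has_derivative[where m = m and a = a and x = x, OF assms]]
  by (simp add: axis_def if_distrib[of "\<lambda>y. y * _"] cong: if_cong)


section \<open>Positivity of the metric in charts\<close>

lemma pd_component_eq:
  assumes "(f has_derivative D) (at z)"
  shows "pd i (\<lambda>y. f y $ j) z = D (axis i 1) $ j"
  by (rule pd_eq_derivative)
    (rule bounded_linear.has_derivative[OF bounded_linear_vec_nth assms])

lemma chart_inv_chart:
  assumes "smooth_atlas \<A>" "\<phi> \<in> \<A>" "x \<in> fst \<phi>"
  shows "chart_inv \<phi> (snd \<phi> x) = x"
  using assms by (auto simp: smooth_atlas_def homeomorphism_def)

lemma open_chart_overlap:
  assumes "smooth_atlas \<A>" "\<phi> \<in> \<A>" "\<psi> \<in> \<A>"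
  shows "open (snd \<phi> ` (fst \<phi> \<inter> fst \<psi>))"
proof -
  have op: "open (fst \<psi>)" "open (chart_image \<phi>)"
    and hom: "homeomorphism (fst \<phi>) (chart_image \<phi>) (snd \<phi>) (chart_inv \<phi>)"
    using assms by (auto simp: smooth_atlas_def)
  have "openin (top_of_set (fst \<phi>)) (fst \<phi> \<inter> fst \<psi>)"
    using op(1) by (rule openin_open_Int)
  then show ?thesis
    using homeomorphism_imp_open_map[OF hom] op(2) openin_open_trans by blast
qed

lemma transition_has_derivative:
  assumes "smooth_atlas \<A>" "\<phi> \<in> \<A>" "\<psi> \<in> \<A>" "x \<in> fst \<phi>" "x \<in> fst \<psi>"
  obtains D where "(transition \<phi> \<psi> has_derivative D) (at (snd \<phi> x))"
proof -
  have "smooth_on (snd \<phi> ` (fst \<phi> \<inter> fst \<psi>)) (transition \<phi> \<psi>)"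
    using assms by (simp add: smooth_atlas_def)
  \<comment> \<open>Level 1 is taken because level 0 of \<open>Ck_on\<close> gives continuity
    only.\<close>
  then have "Ck_on (Suc 0) (snd \<phi> ` (fst \<phi> \<inter> fst \<psi>)) (transition \<phi> \<psi>)"
    unfolding smooth_on_def by blast
  then have "transition \<phi> \<psi> differentiable_on (snd \<phi> ` (fst \<phi> \<inter> fst \<psi>))"
    by simp
  then have "transition \<phi> \<psi> differentiable (at (snd \<phi> x))"
    using assms open_chart_overlap[OF assms(1-3)]
    by (auto simp: differentiable_on_eq_differentiable_at)
  then show thesis
    using that by (auto simp: differentiable_def)
qed

lemma pd_transition_chain:
  assumes "smooth_atlas \<A>" "\<phi> \<in> \<A>" "\<psi> \<in> \<A>" "\<theta> \<in> \<A>"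
    and "x \<in> fst \<phi>" "x \<in> fst \<psi>" "x \<in> fst \<theta>"
  shows "pd i (\<lambda>y. transition \<phi> \<theta> y $ l) (snd \<phi> x) =
    (\<Sum>j\<in>UNIV. pd i (\<lambda>y. transition \<phi> \<psi> y $ j) (snd \<phi> x) *
      pd j (\<lambda>y. transition \<psi> \<theta> y $ l) (snd \<psi> x))"
proof -
  obtain D where D: "(transition \<phi> \<psi> has_derivative D) (at (snd \<phi> x))"
    using transition_has_derivative[OF assms(1,2,3,5,6)] .
  obtain E where E: "(transition \<psi> \<theta> has_derivative E) (at (snd \<psi> x))"
    using transition_has_derivative[OF assms(1,3,4,6,7)] .
  have "transition \<phi> \<psi> (snd \<phi> x) = snd \<psi> x"
    using chart_inv_chart[OF assms(1,2,5)] by (simp add: transition_def)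
  then have comp: "((\<lambda>y. transition \<psi> \<theta> (transition \<phi> \<psi> y)) has_derivative (\<lambda>v. E (D v))) (at (snd \<phi> x))"
    using has_derivative_compose[OF D, of "transition \<psi> \<theta>" E] E by simp
  have "pd i (\<lambda>y. transition \<phi> \<theta> y $ l) (snd \<phi> x) =
      pd i (\<lambda>y. transition \<psi> \<theta> (transition \<phi> \<psi> y) $ l) (snd \<phi> x)"
  proof (rule pd_cong_open[OF open_chart_overlap[OF assms(1,2,3)]])
    show "snd \<phi> x \<in> snd \<phi> ` (fst \<phi> \<inter> fst \<psi>)" using assms by auto
    \<comment> \<open>Both sides are \<open>snd \<theta>\<close> at the same point of the manifold.
      As coordinate maps are total functions, this holds on the whole overlap of
      \<open>\<phi>\<close> and \<open>\<psi>\<close>, including points outside the domain of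
      \<open>\<theta>\<close>.\<close>
    show "transition \<phi> \<theta> q $ l = transition \<psi> \<theta> (transition \<phi> \<psi> q) $ l"
      if "q \<in> snd \<phi> ` (fst \<phi> \<inter> fst \<psi>)" for q
      using that chart_inv_chart[OF assms(1,2)] chart_inv_chart[OF assms(1,3)]
      by (auto simp: transition_def)
  qed
  also have "\<dots> = E (D (axis i 1)) $ l"
    by (rule pd_component_eq[OF comp])
  also have "\<dots> = E (\<Sum>j\<in>UNIV. D (axis i 1) $ j *\<^sub>R axis j 1) $ l"
    using basis_expansion[of "D (axis i 1)"] by (simp add: scalar_mult_eq_scaleR)
  also have "\<dots> = (\<Sum>j\<in>UNIV. D (axis i 1) $ j * E (axis j 1) $ l)"
    using has_derivative_linear[OF E] by (simp add: linear_sum linear_scale)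
  finally show ?thesis
    by (simp add: pd_component_eq[OF D] pd_component_eq[OF E])
qed

lemma pd_transition_self:
  assumes "smooth_atlas \<A>" "\<phi> \<in> \<A>" "x \<in> fst \<phi>"
  shows "pd i (\<lambda>y. transition \<phi> \<phi> y $ j) (snd \<phi> x) = axis i 1 $ j"
proof -
  have "pd i (\<lambda>y. transition \<phi> \<phi> y $ j) (snd \<phi> x) = pd i (\<lambda>y. y $ j) (snd \<phi> x)"
    using assms chart_inv_chart[OF assms(1,2)]
    by (intro pd_cong_open[OF open_chart_overlap[OF assms(1,2,2)]]) (auto simp: transition_def)
  also have "\<dots> = axis i 1 $ j"
    by (rule pd_component_eq) (rule has_derivative_ident)
  finally show ?thesis .
qed

text \<open>Fibrewise surjectivity of the bundle chart: it ensures that \<open>inv_into\<close> in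
  \<open>in_chart\<close> selects a genuine covector.\<close>

lemma cotangent_vector_with_components:
  assumes "smooth_atlas \<A>" "\<phi> \<in> \<A>" "x \<in> fst \<phi>"
  obtains \<xi> where "\<xi> \<in> cotangent_space \<A> x" "\<xi> \<phi> = p"
proof
  \<comment> \<open>The transformation law with \<open>\<phi>\<close> as reference chart forces
    these components. Compatibility between two other charts is then the chain rule for transition
    maps.\<close>
  define \<xi> where "\<xi> \<psi> = (if \<psi> \<in> \<A> \<and> x \<in> fst \<psi>
      then \<chi> i. \<Sum>j\<in>UNIV. pd i (\<lambda>y. transition \<psi> \<phi> y $ j) (snd \<psi> x) * p $ j else 0)" for \<psi>
  show "\<xi> \<in> cotangent_space \<A> x"
    unfolding cotangent_space_def
  proof (intro CollectI conjI ballI allI impI)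
    fix \<psi> \<theta> i assume *: "\<psi> \<in> \<A>" "\<theta> \<in> \<A>" "x \<in> fst \<psi> \<inter> fst \<theta>"
    have chain: "pd i (\<lambda>y. transition \<psi> \<phi> y $ l) (snd \<psi> x) =
        (\<Sum>j\<in>UNIV. pd i (\<lambda>y. transition \<psi> \<theta> y $ j) (snd \<psi> x) *
          pd j (\<lambda>y. transition \<theta> \<phi> y $ l) (snd \<theta> x))" for l
      using * assms by (intro pd_transition_chain[where \<A> = \<A>]) auto
    have "\<xi> \<psi> $ i = (\<Sum>l\<in>UNIV. pd i (\<lambda>y. transition \<psi> \<phi> y $ l) (snd \<psi> x) * p $ l)"
      using * by (simp add: \<xi>_def)
    also have "\<dots> = (\<Sum>l\<in>UNIV. (\<Sum>j\<in>UNIV. pd i (\<lambda>y. transition \<psi> \<theta> y $ j) (snd \<psi> x) *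
      pd j (\<lambda>y. transition \<theta> \<phi> y $ l) (snd \<theta> x)) * p $ l)"
      by (simp only: chain)
    also have "\<dots> = (\<Sum>j\<in>UNIV. \<Sum>l\<in>UNIV. pd i (\<lambda>y. transition \<psi> \<theta> y $ j) (snd \<psi> x) *
      (pd j (\<lambda>y. transition \<theta> \<phi> y $ l) (snd \<theta> x) * p $ l))"
      unfolding sum_distrib_right by (subst sum.swap) (simp add: mult_ac)
    also have "\<dots> = (\<Sum>j\<in>UNIV. pd i (\<lambda>y. transition \<psi> \<theta> y $ j) (snd \<psi> x) * \<xi> \<theta> $ j)"
      using * by (simp add: \<xi>_def sum_distrib_left)
    finally show "\<xi> \<psi> $ i = \<dots>" .
  qed (auto simp: \<xi>_def)
  show "\<xi> \<phi> = p"
    using assms by (simp add: \<xi>_def vec_eq_iff pd_transition_self[where \<A> = \<A>] axis_def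
        if_distrib[of "\<lambda>y. y * _"] cong: if_cong)
qed

lemma cartan_space_in_chart_pos:
  assumes "cartan_space \<A> K" "\<phi> \<in> \<A>" "x \<in> chart_image \<phi>" "p \<noteq> 0"
  shows "in_chart \<A> \<phi> K x p > 0"
proof -
  have atlas: "smooth_atlas \<A>"
    and pos: "\<And>y \<xi>. (y, \<xi>) \<in> cotangent_bundle \<A> \<Longrightarrow> \<xi> \<noteq> (\<lambda>_. 0) \<Longrightarrow> K (y, \<xi>) > 0"
    using assms(1) unfolding cartan_space_def by auto
  obtain y where y: "y \<in> fst \<phi>" "x = snd \<phi> y"
    using assms(3) by (auto simp: chart_image_def)
  obtain \<xi> where \<xi>: "\<xi> \<in> cotangent_space \<A> y" "\<xi> \<phi> = p"
    using cotangent_vector_with_components[OF atlas assms(2) y(1)] .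
  define B where "B = {v \<in> cotangent_bundle \<A>. fst v \<in> fst \<phi>}"
  define v where "v = inv_into B (bundle_chart \<phi>) (x, p)"
  \<comment> \<open>Membership in the image makes \<open>v\<close> an actual preimage, so its
    component vector in \<open>\<phi>\<close> is \<open>p\<close> and \<open>v\<close> is a nonzero
    covector.\<close>
  have "(x, p) \<in> bundle_chart \<phi> ` B"
    using y \<xi> by (auto simp: B_def cotangent_bundle_def bundle_chart_def image_iff intro!: bexI[of _ "(y, \<xi>)"])
  then have "v \<in> B" "bundle_chart \<phi> v = (x, p)"
    unfolding v_def by (auto intro: inv_into_into f_inv_into_f)
  then have "v \<in> cotangent_bundle \<A>" "snd v \<phi> \<noteq> 0"
    using assms(4) by (auto simp: B_def bundle_chart_def)
  then have "K v > 0" using pos[of "fst v" "snd v"] by fastforce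
  then show ?thesis by (simp add: in_chart_def v_def B_def)
qed


section \<open>Parity of the curvature quantities\<close>

text \<open>One chart and one base point are frozen. The \<open>x\<close>-derivatives occur only
  inside the Christoffel symbols, which are then constants, and everything else is calculus in
  \<open>p\<close>.\<close>

locale mth_root_chart =
  fixes m :: nat and k :: "real^'n::finite \<Rightarrow> real^'n \<Rightarrow> real"
    and a :: "'n list \<Rightarrow> real^'n \<Rightarrow> real" and x :: "real^'n"
  assumes m_ge_3: "m \<ge> 3"
    and sym: "\<And>I J. length I = m \<Longrightarrow> mset I = mset J \<Longrightarrow> a I x = a J x"
    and k_root: "\<And>p. k x p = root m (contract a m [] x p)"
    and k_pos: "\<And>p. p \<noteq> 0 \<Longrightarrow> k x p > 0"
    and fund_pos: "\<And>p v. p \<noteq> 0 \<Longrightarrow> v \<noteq> 0 \<Longrightarrow>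
      (\<Sum>i\<in>UNIV. \<Sum>j\<in>UNIV. fund_tensor k i j x p * v $ i * v $ j) > 0"
begin

abbreviation F :: "real^'n \<Rightarrow> real" where "F \<equiv> contract a m [] x"

lemma F_pos: "p \<noteq> 0 \<Longrightarrow> F p > 0"
  using k_pos[of p] m_ge_3 by (simp add: k_root)

lemma even_m: "even m"
proof (rule ccontr)
  assume "odd m"
  \<comment> \<open>A nonzero covector exists because the index type is nonempty.\<close>
  define p :: "real^'n" where "p = axis undefined 1"
  have "p \<noteq> 0" by (simp add: p_def)
  then have "F p > 0" "F (- p) > 0" by (simp_all add: F_pos)
  with \<open>odd m\<close> show False by (simp add: contract_minus)
qed

lemma k_minus: "k x (- p) = k x p"
  using even_m by (simp add: k_root contract_minus)

lemma k_eq_powr: "p \<noteq> 0 \<Longrightarrow> k x p = F p powr (1 / m)"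
  using F_pos[of p] m_ge_3 by (simp add: k_root root_powr_inverse)

lemma k_square_eq_powr: "p \<noteq> 0 \<Longrightarrow> (k x p)\<^sup>2 = F p powr (2 / m)"
  by (simp add: k_eq_powr powr_powr power2_eq_square flip: powr_add)

lemma elementary_F_powr: "elementary (\<lambda>p. F p powr c)"
  by (intro elementary.power_real elementary_contract F_pos)

lemma elementary_k_square: "elementary (\<lambda>p. (k x p)\<^sup>2)"
  by (rule elementary.cong[OF elementary_F_powr k_square_eq_powr])

lemma elementary_fund_tensor: "elementary (fund_tensor k i j x)"
  unfolding fund_tensor_def
  by (intro elementary.mult elementary.const elementary_pd elementary_k_square)

lemma fund_tensor_minus: "p \<noteq> 0 \<Longrightarrow> fund_tensor k i j x (- p) = fund_tensor k i j x p"
  unfolding fund_tensor_def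
  \<comment> \<open>The value \<open>s = 1\<close> makes the first derivative of the even function
    K^2 odd, and \<open>s = - 1\<close> makes the second derivative even again.\<close>
  using elementary_pd_reflect[OF elementary_pd[OF elementary_k_square], where s = "- 1"]
    elementary_pd_reflect[OF elementary_k_square, where s = 1]
  by (simp add: k_minus)

lemma cartan_torsion_minus:
  "p \<noteq> 0 \<Longrightarrow> cartan_torsion k i j l x (- p) = - cartan_torsion k i j l x p"
  unfolding cartan_torsion_def
  using elementary_pd_reflect[OF elementary_fund_tensor, where s = 1]
  by (simp add: fund_tensor_minus)

section \<open>Explicit metric tensor and invertibility of the matrix a^{ij}\<close>

lemma pd_F_powr:
  fixes c :: real
  assumes "p \<noteq> 0"
  shows "pd i (\<lambda>q. F q powr c) p = m * c * F p powr (c - 1) * contract a (m - 1) [i] x p"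
proof -
  have "((\<lambda>y. y powr c) has_derivative (\<lambda>v. (c * F p powr (c - 1)) * v)) (at (F p))"
    using has_real_derivative_powr[OF F_pos[OF assms], of c]
    by (simp add: has_field_derivative_def)
  from has_derivative_compose[OF contract_has_derivative[where m = m and a = a and x = x, OF sym] this]
  have "pd i (\<lambda>q. F q powr c) p
      = (c * F p powr (c - 1)) * (m * (\<Sum>j\<in>UNIV. axis i 1 $ j * contract a (m - 1) [j] x p))"
    by (intro pd_eq_derivative) simp
  then show ?thesis
    by (simp add: axis_def if_distrib[of "\<lambda>y. y * _"] cong: if_cong)
qed

text \<open>Differentiating K^2 = F^(2/m) twice gives the decomposition g^{ij} = (m-1) a^{ij} -
  (m-2) a^i a^j, where a^i is K^(1-m) times \<open>contract a (m - 1) [i] x p\<close> and powers of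
  K are written as powers of F = K^m.\<close>

lemma fund_tensor_eq:
  assumes "p \<noteq> 0"
  shows "fund_tensor k i j x p =
    (m - 1) * F p powr (2 / m - 1) * contract a (m - 2) [i, j] x p
    - (m - 2) * F p powr (2 / m - 2) * contract a (m - 1) [i] x p * contract a (m - 1) [j] x p"
proof -
  let ?c = "2 / real m - 1"
  have D1: "pd j (\<lambda>q. (k x q)\<^sup>2) q = 2 * (F q powr ?c * contract a (m - 1) [j] x q)" if "q \<noteq> 0" for q
  proof -
    have "pd j (\<lambda>q. (k x q)\<^sup>2) q = pd j (\<lambda>q. F q powr (2 / m)) q"
      using that by (intro pd_cong_nonzero k_square_eq_powr)
    then show ?thesis using that m_ge_3 by (simp add: pd_F_powr)
  qed
  obtain D where D: "((\<lambda>q. F q powr ?c) has_derivative D) (at p)"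
    using elementary_differentiable[OF elementary_F_powr assms] by (auto simp: differentiable_def)
  obtain E where E: "(contract a (m - 1) [j] x has_derivative E) (at p)"
    using elementary_differentiable[OF elementary_contract assms] unfolding differentiable_def by blast
  have "fund_tensor k i j x p = 1/2 * pd i (\<lambda>q. 2 * (F q powr ?c * contract a (m - 1) [j] x q)) p"
    unfolding fund_tensor_def using pd_cong_nonzero[OF assms D1] by simp
  also have "\<dots> = F p powr ?c * E (axis i 1) + D (axis i 1) * contract a (m - 1) [j] x p"
    using pd_eq_derivative[OF has_derivative_mult_right[OF has_derivative_mult[OF D E]], of i 2]
    by simp
  also have "D (axis i 1) = m * ?c * F p powr (?c - 1) * contract a (m - 1) [i] x p"
    using pd_eq_derivative[OF D] pd_F_powr[OF assms] by simp
  also have "E (axis i 1) = (m - 1) * contract a (m - 2) [i, j] x p"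
  proof -
    have "E (axis i 1) = (m - 1) * contract a (m - 1 - 1) ([j] @ [i]) x p"
      using pd_eq_derivative[OF E] pd_contract[where m = m and a = a and x = x, OF sym, of "[j]" "m - 1" i p] m_ge_3 by simp
    also have "contract a (m - 1 - 1) ([j] @ [i]) x p = contract a (m - 1 - 1) [i, j] x p"
      using m_ge_3 by (intro contract_mset_eq[where m = m and a = a and x = x, OF sym]) auto
    finally show ?thesis by (simp add: numeral_2_eq_2)
  qed
  \<comment> \<open>This is the origin of the negative sign of the rank-one term.\<close>
  also have "real m * ?c = - real (m - 2)"
    using m_ge_3 by (simp add: field_simps of_nat_diff)
  finally show ?thesis using m_ge_3 by (simp add: algebra_simps of_nat_diff)
qed

text \<open>Together with \<open>spray_rhs\<close> it turns the system behind \<open>spray\<close>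
  into a matrix equation to which Cramer's rule applies.\<close>

definition spray_matrix :: "real^'n \<Rightarrow> real^'n^'n" where
  "spray_matrix p = (\<chi> h r. a_matrix m k a h r x p)"

definition spray_rhs :: "real^'n \<Rightarrow> real^'n" where
  "spray_rhs p = (\<chi> h. 1 / (real m * k x p ^ (m - 2)) * christoffel0 m a h x p)"

text \<open>On the kernel of the matrix \<open>a\<^sup>i\<^sup>j\<close>, the form \<open>g\<^sup>i\<^sup>j\<close> is minus a square.\<close>

lemma det_spray_matrix:
  assumes "p \<noteq> 0"
  shows "det (spray_matrix p) \<noteq> 0"
proof
  assume "det (spray_matrix p) = 0"
  then obtain v where v: "v \<noteq> 0" "spray_matrix p *v v = 0"
    using invertible_det_nz matrix_left_invertible_ker invertible_left_inverse by metis
  have "(\<Sum>j\<in>UNIV. contract a (m - 2) [i, j] x p * v $ j) = 0" for i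
  proof -
    have "(\<Sum>j\<in>UNIV. a_matrix m k a i j x p * v $ j) = 0"
      using v(2) by (simp add: spray_matrix_def matrix_vector_mult_def vec_eq_iff)
    then have "(\<Sum>j\<in>UNIV. contract a (m - 2) [i, j] x p * v $ j) / k x p ^ (m - 2) = 0"
      by (simp add: a_matrix_def sum_divide_distrib)
    then show ?thesis using k_pos[OF assms] by simp
  qed
  then have ker: "(\<Sum>i\<in>UNIV. \<Sum>j\<in>UNIV. contract a (m - 2) [i, j] x p * v $ i * v $ j) = 0"
    by (simp add: mult_ac flip: sum_distrib_left)
  let ?s = "\<Sum>i\<in>UNIV. contract a (m - 1) [i] x p * v $ i"
  have "(\<Sum>i\<in>UNIV. \<Sum>j\<in>UNIV. fund_tensor k i j x p * v $ i * v $ j)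
      = (m - 1) * F p powr (2 / m - 1) * (\<Sum>i\<in>UNIV. \<Sum>j\<in>UNIV. contract a (m - 2) [i, j] x p * v $ i * v $ j)
        - (m - 2) * F p powr (2 / m - 2) * (?s * ?s)"
    unfolding fund_tensor_eq[OF assms] sum_product
    by (simp add: left_diff_distrib right_diff_distrib sum_subtractf sum_distrib_left mult_ac)
  also have "\<dots> \<le> 0"
    unfolding ker by simp
  finally show False using fund_pos[OF assms v(1)] by simp
qed

section \<open>Regularity of the spray coefficients in p\<close>

lemma elementary_k_power_inverse: "elementary (\<lambda>p. inverse (k x p ^ r))"
proof -
  have "elementary (\<lambda>p. k x p)"
    by (rule elementary.cong[OF elementary_F_powr k_eq_powr])
  then have "elementary (\<lambda>p. k x p ^ r)"
    by (induction r) (auto intro: elementary.const elementary.mult)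
  then show ?thesis
    using k_pos by (intro elementary_inverse) (auto simp: less_imp_neq[symmetric])
qed

text \<open>A value chosen by \<open>THE\<close> carries no visible regularity. Cramer's rule
  exhibits it as a quotient of determinants with elementary entries and nonvanishing
  denominator.\<close>

lemma elementary_spray: "elementary (\<lambda>q. spray m k a x q $ r)"
proof (rule elementary.cong)
  \<comment> \<open>The numerator matrix of Cramer's rule: column \<open>r\<close> is replaced by
    the right-hand side.\<close>
  define N where "N p = (\<chi> i j. if j = r then spray_rhs p $ i else spray_matrix p $ i $ j)" for p
  have M: "elementary (\<lambda>p. spray_matrix p $ i $ j)" for i j
    unfolding spray_matrix_def a_matrix_def divide_inverse
    by (simp, intro elementary.mult elementary_contract elementary_k_power_inverse)
  have R: "elementary (\<lambda>p. spray_rhs p $ i)" for i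
    unfolding spray_rhs_def christoffel0_def divide_inverse
    by (simp, intro elementary.mult elementary_sum elementary_monomial elementary.const
        elementary_k_power_inverse)
  have "elementary (\<lambda>p. N p $ i $ j)" for i j
    using M R by (cases "j = r") (simp_all add: N_def)
  then show "elementary (\<lambda>p. det (N p) * inverse (det (spray_matrix p)))"
    by (intro elementary.mult elementary_det elementary_inverse M det_spray_matrix)
  fix p :: "real^'n" assume p: "p \<noteq> 0"
  have "spray m k a x p = (THE G. spray_matrix p *v G = spray_rhs p)"
    by (simp add: spray_def spray_matrix_def spray_rhs_def matrix_vector_mult_def vec_eq_iff)
  \<comment> \<open>The nonzero determinant makes the solution unique, so \<open>THE\<close> denotes
    Cramer's vector.\<close>
  also have "\<dots> = (\<chi> l. det (\<chi> i j. if j = l then spray_rhs p $ i else spray_matrix p $ i $ j)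
      / det (spray_matrix p))"
    by (simp add: cramer[OF det_spray_matrix[OF p]])
  finally show "spray m k a x p $ r = det (N p) * inverse (det (spray_matrix p))"
    by (simp add: N_def divide_inverse)
qed

section \<open>Parity of the spray, Berwald and Landsberg coefficients\<close>

lemma spray_minus: "spray m k a x (- p) = spray m k a x p"
proof -
  have "a_matrix m k a h r x (- p) = a_matrix m k a h r x p" for h r
    using even_m by (simp add: a_matrix_def contract_minus k_minus)
  moreover have "christoffel0 m a h x (- p) = christoffel0 m a h x p" for h
    unfolding christoffel0_def using even_m by (intro sum.cong) (auto simp: monomial_minus)
  \<comment> \<open>The systems at \<open>p\<close> and \<open>- p\<close> have the same
    coefficients and right-hand sides, hence the two \<open>THE\<close> terms coincide.\<close>
  ultimately show ?thesis by (simp add: spray_def k_minus)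
qed

lemma berwald_minus:
  assumes "p \<noteq> 0"
  shows "berwald m k a i j l r x (- p) = - berwald m k a i j l r x p"
proof -
  let ?G = "\<lambda>q. spray m k a x q $ r"
  have "pd i ?G (- q) = - 1 * pd i ?G q" if "q \<noteq> 0" for q
    using elementary_pd_reflect[OF elementary_spray, where s = 1] that by (simp add: spray_minus)
  \<comment> \<open>The sign is left as \<open>- (- 1)\<close> to match the shape \<open>- s\<close>
    with \<open>s = - 1\<close>.\<close>
  then have "pd j (pd i ?G) (- q) = - (- 1) * pd j (pd i ?G) q" if "q \<noteq> 0" for q
    using that by (intro elementary_pd_reflect[OF elementary_pd[OF elementary_spray]])
  then show ?thesis
    unfolding berwald_def
    using elementary_pd_reflect[OF elementary_pd[OF elementary_pd[OF elementary_spray]], where s = 1] assms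
    by simp
qed

text \<open>The contracting vector p^s = g^{sr} p_r is odd and so is the Berwald curvature, hence
  the product is even.\<close>

lemma landsberg_minus:
  assumes "p \<noteq> 0"
  shows "landsberg m k a i j l x (- p) = landsberg m k a i j l x p"
  using assms by (simp add: landsberg_def fund_tensor_minus berwald_minus sum_negf)

text \<open>Adding the equations at \<open>p\<close> and \<open>- p\<close> cancels the torsion
  terms and leaves 2L = 0. The same \<open>c\<close> serves both because it depends on the base
  point alone.\<close>

lemma isotropic_landsberg_vanishes:
  assumes iso: "\<And>q. q \<noteq> 0 \<Longrightarrow>
      landsberg m k a i j l x q + c * k x q * cartan_torsion k i j l x q = 0"
    and "p \<noteq> 0"
  shows "landsberg m k a i j l x p = 0"
  using iso[of p] iso[of "- p"] assms(2)
  by (simp add: landsberg_minus cartan_torsion_minus k_minus)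

end

theorem theorem1p1:
  fixes \<A> :: "('m::{t2_space, second_countable_topology}, 'n::finite) chart set"
    and m :: nat
    and K :: "'m \<times> ('m, 'n) covector \<Rightarrow> real"
    and a :: "('m, 'n) chart \<Rightarrow> 'n list \<Rightarrow> real^'n \<Rightarrow> real"
  assumes "m \<ge> 3"
    and "mth_root_cartan_space \<A> m K a"
    and "isotropic_landsberg_metric \<A> m K a"
  shows "landsberg_metric \<A> m K a"
proof -
  obtain c where c: "\<And>\<phi> x p i j l. \<phi> \<in> \<A> \<Longrightarrow> x \<in> chart_image \<phi> \<Longrightarrow> p \<noteq> 0 \<Longrightarrow>
      landsberg m (in_chart \<A> \<phi> K) (a \<phi>) i j l x p
        + c (chart_inv \<phi> x) * in_chart \<A> \<phi> K x p * cartan_torsion (in_chart \<A> \<phi> K) i j l x p = 0"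
    using assms(3) unfolding isotropic_landsberg_metric_def by blast
  have cartan: "cartan_space \<A> K"
    using assms(2) by (simp add: mth_root_cartan_space_def)
  \<comment> \<open>Positivity is assumed for covectors and must be carried into the chart; the
    other locale assumptions are the bound on \<open>m\<close> and clauses of the
    definitions.\<close>
  have "mth_root_chart m (in_chart \<A> \<phi> K) (a \<phi>) x" if "\<phi> \<in> \<A>" "x \<in> chart_image \<phi>" for \<phi> x
  proof
    show "in_chart \<A> \<phi> K x p > 0" if "p \<noteq> 0" for p
      using cartan_space_in_chart_pos[OF cartan] \<open>\<phi> \<in> \<A>\<close> \<open>x \<in> chart_image \<phi>\<close> that .
    show "(\<Sum>i\<in>UNIV. \<Sum>j\<in>UNIV. fund_tensor (in_chart \<A> \<phi> K) i j x p * v $ i * v $ j) > 0"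
      if "p \<noteq> 0" "v \<noteq> 0" for p v
      using cartan \<open>\<phi> \<in> \<A>\<close> \<open>x \<in> chart_image \<phi>\<close> that unfolding cartan_space_def by blast
  qed (use assms(1,2) that in \<open>auto simp: mth_root_cartan_space_def\<close>)
  then show ?thesis
    unfolding landsberg_metric_def
    using mth_root_chart.isotropic_landsberg_vanishes c by blast
qed

end
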